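(* Let $k \geq 1$ and $p \geq 1$ be integers, let $B \in \mathbb{R}^{N\times N}$, let $P \in \mathbb{R}^{N\times N}$ be a diagonal matrix whose diagonal entries are each $0$ or $1$, and let $y(t) = e^{tB}y^0$ be the solution of $y'(t) = B y(t)$ for some $y^0 \in \mathbb{R}^N$. Fix $t_n$ and $\Delta t > 0$. Apply one step of the LTS-AB$k$($p$) scheme (defined in the context) with exact input data $$y_{n-\ell} = y(t_n - \ell \Delta t), \quad \ell = 0,\dots,k-1, \qquad \widetilde y_{-j/p} = P\, y(t_n - j\Delta t/p), \quad j = 1,\dots,k-1,$$ producing $y_{n+1}$. Then the scheme is consistent of order $k$: there is a constant $C$ depending only on $k$, $p$, $B$, $P$ and $y^0$ (and on an upper bound for $|t_n|$) such that for all sufficiently small $\Delta t>0$, $$\| y_{n+1} - y(t_n + \Delta t)\| \leq C\, \Delta t^{k+1}.$$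
   Context: Polynomials: for integer $j\ge 0$, $\gamma_j(\xi) = (-1)^j \int_0^{\xi} \binom{-s}{j}\, ds$ and $\widetilde\gamma_j(\xi) = \gamma_j'(\xi) = (-1)^j\binom{-\xi}{j} = \xi(\xi+1)\cdots(\xi+j-1)/j!$ (with $\widetilde\gamma_0\equiv 1$), where $\binom{x}{j} = x(x-1)\cdots(x-j+1)/j!$. Adams–Bashforth coefficients: $\alpha_\ell = (-1)^\ell \sum_{i=\ell}^{k-1}\binom{i}{\ell}\gamma_i(1)$, $\ell=0,\dots,k-1$ (the classical $k$-step Adams–Bashforth scheme is $y_{n+1} = y_n + \Delta t\, B\sum_{\ell=0}^{k-1}\alpha_\ell y_{n-\ell}$). LTS coefficients: $\beta_{m,\ell} = \sum_{i=0}^{k-1} \alpha_i \sum_{j=\ell}^{k-1} (-1)^\ell \binom{j}{\ell}\, \widetilde\gamma_j\!\left(\frac{m-i}{p}\right)$ for $m=0,\dots,p-1$, $\ell=0,\dots,k-1$. LTS-AB$k$($p$) step: set $\widetilde y_0 := y_n$ (the values $\widetilde y_{-j/p}$, $j=1,\dots,k-1$, are given inputs; note $\widetilde y_{-j/p}$ for $j \geq p$ refers to a past time $t_n - j\Delta t/p$ as well). For $m = 0,1,\dots,p-1$ compute $$\widetilde y_{(m+1)/p} = \widetilde y_{m/p} + \frac{\Delta t}{p}\, B(I-P)\sum_{\ell=0}^{k-1}\beta_{m,\ell}\, y_{n-\ell} + \frac{\Delta t}{p}\, BP\sum_{\ell=0}^{k-1}\alpha_\ell\, \widetilde y_{(m-\ell)/p},$$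 and set $y_{n+1} := \widetilde y_1$. For $P=0$ or $p=1$ this reduces to the classical $k$-step Adams–Bashforth method. Here $I$ is the $N\times N$ identity and $\|\cdot\|$ any norm on $\mathbb{R}^N$. *)

theory Defs
  imports "HOL-Analysis.Analysis"
begin

text \<open>gamma_j(xi) = (-1)^j * integral from 0 to xi of binom(-s, j) ds (oriented integral).\<close>
definition ab_gamma :: "nat \<Rightarrow> real \<Rightarrow> real" where
  "ab_gamma j \<xi> = (-1) ^ j *
     (if 0 \<le> \<xi> then integral {0..\<xi>} (\<lambda>s. (- s) gchoose j)
      else - integral {\<xi>..0} (\<lambda>s. (- s) gchoose j))"

text \<open>tilde gamma_j(xi) = (-1)^j binom(-xi, j).\<close>
definition ab_gamma_tilde :: "nat \<Rightarrow> real \<Rightarrow> real" where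
  "ab_gamma_tilde j \<xi> = (-1) ^ j * ((- \<xi>) gchoose j)"

text \<open>Adams--Bashforth coefficients alpha_l for the k-step scheme.\<close>
definition ab_alpha :: "nat \<Rightarrow> nat \<Rightarrow> real" where
  "ab_alpha k l = (-1) ^ l * (\<Sum>i = l..<k. real (i choose l) * ab_gamma i 1)"

text \<open>LTS coefficients beta_{m,l}.\<close>
definition lts_beta :: "nat \<Rightarrow> nat \<Rightarrow> nat \<Rightarrow> nat \<Rightarrow> real" where
  "lts_beta k p m l = (\<Sum>i<k. ab_alpha k i *
      (\<Sum>j = l..<k. (-1) ^ l * real (j choose l) *
          ab_gamma_tilde j ((real m - real i) / real p)))"

text \<open>History of the inner LTS stages: lts_hist ... m q is tilde y_{q/p}
  for integer q with -(k-1) <= q <= m.  Inputs: yh l = y_{n-l} (l = 0..k-1),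
  yin j = tilde y_{-j/p} (j = 1..k-1).  tilde y_0 := y_n.\<close>
primrec lts_hist :: "nat \<Rightarrow> nat \<Rightarrow> real^'n^'n \<Rightarrow> real^'n^'n \<Rightarrow> real \<Rightarrow>
    (nat \<Rightarrow> real^'n) \<Rightarrow> (nat \<Rightarrow> real^'n) \<Rightarrow> nat \<Rightarrow> int \<Rightarrow> real^'n" where
  "lts_hist k p B P dt yh yin 0 =
     (\<lambda>q. if q = 0 then yh 0 else yin (nat (- q)))"
| "lts_hist k p B P dt yh yin (Suc m) =
     (let h = lts_hist k p B P dt yh yin m in
      h(int (Suc m) :=
          h (int m)
          + (dt / real p) *\<^sub>R ((B ** (mat 1 - P)) *v (\<Sum>l<k. lts_beta k p m l *\<^sub>R yh l))
          + (dt / real p) *\<^sub>R ((B ** P) *v (\<Sum>l<k. ab_alpha k l *\<^sub>R h (int m - int l)))))"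

text \<open>One LTS-ABk(p) step: y_{n+1} := tilde y_1 = tilde y_{p/p}.\<close>
definition lts_step :: "nat \<Rightarrow> nat \<Rightarrow> real^'n^'n \<Rightarrow> real^'n^'n \<Rightarrow> real \<Rightarrow>
    (nat \<Rightarrow> real^'n) \<Rightarrow> (nat \<Rightarrow> real^'n) \<Rightarrow> real^'n" where
  "lts_step k p B P dt yh yin = lts_hist k p B P dt yh yin p (int p)"

end

theory Submission
  imports Defs "HOL-Computational_Algebra.Polynomial"
begin

text \<open>
  Consistency of order k of one LTS-ABk(p) step for the linear ODE y' = B y.

  The proof has three parts.
  (1) Exactness of the coefficients.  Writing the tilde-gamma functions as real
  polynomials and using Newton's backward interpolation formula, the
  Adams--Bashforth weights alpha integrate every polynomial of degree < k over
  [0,1] exactly from its values at 0, -1, ..., -(k-1), and the LTS weights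
  beta_{m,l}, applied to samples on the coarse grid, reproduce the
  alpha-weighted fine-grid samples.  In particular both rules are exact on the
  monomials s^r, r < k.
  (2) Local defect of one substep.  The solution is replaced by its Taylor
  polynomial of degree k-1 (resp. k) around t_n, with a remainder bound uniform
  on compact time intervals.  By (1) both quadratures in a substep reproduce the
  same integral of the Taylor polynomial, and the splitting
  B (I - P) + B P = B shows that each substep has defect O(dt^(k+1)).
  (3) Propagation through the p substeps.  Since P is a diagonal 0/1 matrix,
  B P annihilates the error of the given past inputs P y(t), so the errors of the
  stages satisfy a recursion whose forcing is the substep defect; induction on
  the stage index gives the bound for the final stage, which is y_{n+1}.
  The argument does not use the hypothesis k >= 1 of the theorem.
\<close>


section \<open>Exactness of the Adams--Bashforth and LTS coefficients on polynomials\<close>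

text \<open>The function tilde gamma_j(xi) = xi (xi+1) ... (xi+j-1) / j! as a polynomial.\<close>
definition tilde_gamma_poly :: "nat \<Rightarrow> real poly" where
  "tilde_gamma_poly j = smult (1 / fact j) (\<Prod>i<j. [:real i, 1:])"

lemma poly_tilde_gamma_poly: "poly (tilde_gamma_poly j) \<xi> = ab_gamma_tilde j \<xi>"
proof -
  have sign: "(-1::real) ^ j * (\<Prod>i = 0..<j. - \<xi> - real i) = (\<Prod>i<j. real i + \<xi>)"
    by (induction j) (auto simp: atLeast0LessThan algebra_simps)
  show ?thesis
    by (simp add: tilde_gamma_poly_def ab_gamma_tilde_def poly_prod gbinomial_prod_rev sign[symmetric])
qed

lemma degree_tilde_gamma_poly: "degree (tilde_gamma_poly j) \<le> j"
proof -
  have "degree (\<Prod>i<j. [:real i, 1:]) \<le> (\<Sum>i<j. degree [:real i, 1:])"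
    using degree_prod_sum_le[of "{..<j}" "\<lambda>i. [:real i, 1:]"] by (simp add: o_def)
  also have "\<dots> = j" by simp
  finally show ?thesis unfolding tilde_gamma_poly_def using degree_smult_le order_trans by blast
qed

text \<open>At the non-positive integers tilde gamma_j is a signed binomial coefficient.\<close>
lemma ab_gamma_tilde_neg_nat: "ab_gamma_tilde j (- real n) = (-1) ^ j * real (n choose j)"
  by (simp add: ab_gamma_tilde_def binomial_gbinomial)

text \<open>Backward differences of a sequence at 0: the j-th difference is
  sum over l of (-1)^l (j choose l) f(l), where f(l) stands for the value at -l.\<close>
definition backward_diff :: "(nat \<Rightarrow> real) \<Rightarrow> nat \<Rightarrow> real" where
  "backward_diff f j = (\<Sum>l\<le>j. (-1) ^ l * real (j choose l) * f l)"

text \<open>The binomial matrix ((-1)^j (n choose j)) is its own inverse; this is the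
  entry-wise statement.\<close>
lemma alternating_binomial_product:
  assumes "l \<le> n"
  shows "(\<Sum>j = l..n. (-1) ^ j * real (n choose j) * real (j choose l)) = (if l = n then (-1) ^ n else 0)"
proof -
  have "(\<Sum>j = l..n. (-1) ^ j * real (n choose j) * real (j choose l))
      = (\<Sum>i = 0..n-l. (-1) ^ (l+i) * real (n choose (l+i)) * real ((l+i) choose l))"
    using sum.atLeastAtMost_shift_0[OF assms] by (simp add: o_def)
  also have "\<dots> = (\<Sum>i = 0..n-l. (-1) ^ l * real (n choose l) * ((-1) ^ i * real ((n-l) choose i)))"
  proof (intro sum.cong refl)
    fix i assume "i \<in> {0..n-l}"
    then have "(n choose (l+i)) * ((l+i) choose l) = (n choose l) * ((n - l) choose i)"
      using assms choose_mult[of l "l+i" n] by simp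
    then have "real (n choose (l+i)) * real ((l+i) choose l) = real (n choose l) * real ((n - l) choose i)"
      by (metis of_nat_mult)
    then show "(-1) ^ (l+i) * real (n choose (l+i)) * real ((l+i) choose l)
             = (-1) ^ l * real (n choose l) * ((-1) ^ i * real ((n-l) choose i))"
      by (simp add: power_add algebra_simps)
  qed
  also have "\<dots> = (-1) ^ l * real (n choose l) * (\<Sum>i\<le>n-l. (-1) ^ i * real ((n-l) choose i))"
    by (simp add: sum_distrib_left atLeast0AtMost)
  also have "\<dots> = (if l = n then (-1) ^ n else 0)"
    using assms choose_alternating_sum[of "n - l", where 'a=real] by auto
  finally show ?thesis .
qed

text \<open>Recovering a sequence from its backward differences.\<close>
lemma backward_diff_inversion:
  assumes "n < k"
  shows "(\<Sum>j<k. (-1) ^ j * real (n choose j) * backward_diff f j) = f n"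
proof -
  let ?c = "\<lambda>j l. (-1) ^ j * real (n choose j) * ((-1) ^ l * real (j choose l) * f l)"
  have "(\<Sum>j<k. (-1) ^ j * real (n choose j) * backward_diff f j)
      = (\<Sum>j\<le>n. (-1) ^ j * real (n choose j) * backward_diff f j)"
    using assms by (intro sum.mono_neutral_right) auto
  also have "\<dots> = (\<Sum>j\<le>n. \<Sum>l\<le>j. ?c j l)"
    by (simp add: backward_diff_def sum_distrib_left)
  also have "\<dots> = (\<Sum>j\<le>n. \<Sum>l | l \<in> {..n} \<and> l \<le> j. ?c j l)"
    by (intro sum.cong refl) auto
  also have "\<dots> = (\<Sum>l\<le>n. \<Sum>j | j \<in> {..n} \<and> l \<le> j. ?c j l)"
    by (rule sum.swap_restrict) auto
  also have "\<dots> = (\<Sum>l\<le>n. \<Sum>j = l..n. ?c j l)"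
    by (intro sum.cong refl) auto
  also have "\<dots> = (\<Sum>l\<le>n. (-1) ^ l * f l * (\<Sum>j = l..n. (-1) ^ j * real (n choose j) * real (j choose l)))"
    by (simp add: sum_distrib_left mult_ac)
  also have "\<dots> = (\<Sum>l\<le>n. if l = n then f n else 0)"
    by (intro sum.cong refl) (auto simp: alternating_binomial_product power_add[symmetric])
  finally show ?thesis by simp
qed

text \<open>Newton's backward interpolation formula: a polynomial of degree < k is
  determined by its values at 0, -1, ..., -(k-1) through the tilde gamma_j.\<close>
lemma newton_backward_interpolation:
  assumes "degree q < k"
  shows "(\<Sum>j<k. ab_gamma_tilde j \<xi> * backward_diff (\<lambda>l. poly q (- real l)) j) = poly q \<xi>"
proof -
  define N where "N = (\<Sum>j<k. smult (backward_diff (\<lambda>l. poly q (- real l)) j) (tilde_gamma_poly j))"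
  have poly_N: "poly N x = (\<Sum>j<k. ab_gamma_tilde j x * backward_diff (\<lambda>l. poly q (- real l)) j)" for x
    by (simp add: N_def poly_sum poly_tilde_gamma_poly mult.commute)
  have "degree N \<le> k - 1"
    unfolding N_def
  proof (rule degree_sum_le)
    fix j assume "j \<in> {..<k}"
    then have "j \<le> k - 1" by auto
    then show "degree (smult (backward_diff (\<lambda>l. poly q (- real l)) j) (tilde_gamma_poly j)) \<le> k - 1"
      using order_trans[OF degree_smult_le order_trans[OF degree_tilde_gamma_poly]] by blast
  qed simp
  then have deg: "degree (q - N) < k"
    using assms degree_diff_le[of q "k-1" N] by linarith
  have roots: "poly (q - N) (- real n) = 0" if "n < k" for n
    using backward_diff_inversion[OF that] by (simp add: poly_N ab_gamma_tilde_neg_nat)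
  have "q - N = 0"
  proof (rule ccontr)
    assume nz: "q - N \<noteq> 0"
    have "(\<lambda>n. - real n) ` {..<k} \<subseteq> {x. poly (q - N) x = 0}" using roots by auto
    then have "card ((\<lambda>n. - real n) ` {..<k}) \<le> card {x. poly (q - N) x = 0}"
      using poly_roots_finite[OF nz] by (intro card_mono) auto
    moreover have "card ((\<lambda>n. - real n) ` {..<k}) = k"
      by (subst card_image) (auto simp: inj_on_def)
    ultimately show False using card_poly_roots_bound[OF nz] deg by linarith
  qed
  then show ?thesis using poly_N[of \<xi>] by simp
qed

text \<open>Exchanging the order of summation over the triangle l <= j < k.\<close>
lemma sum_triangle_swap:
  "(\<Sum>l<(k::nat). \<Sum>j = l..<k. F j l) = (\<Sum>j<k. \<Sum>l\<le>j. F j l :: real)"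
proof -
  have "(\<Sum>l<k. \<Sum>j = l..<k. F j l) = (\<Sum>l<k. \<Sum>j | j \<in> {..<k} \<and> l \<le> j. F j l)"
    by (intro sum.cong refl) auto
  also have "\<dots> = (\<Sum>j<k. \<Sum>l | l \<in> {..<k} \<and> l \<le> j. F j l)"
    by (rule sum.swap_restrict) auto
  also have "\<dots> = (\<Sum>j<k. \<Sum>l\<le>j. F j l)"
    by (intro sum.cong refl) auto
  finally show ?thesis .
qed

text \<open>The Adams--Bashforth rule in its classical backward-difference form.\<close>
lemma ab_sum_backward_diff:
  "(\<Sum>l<k. ab_alpha k l * f l) = (\<Sum>i<k. ab_gamma i 1 * backward_diff f i)"
proof -
  have "(\<Sum>l<k. ab_alpha k l * f l) = (\<Sum>l<k. \<Sum>i = l..<k. ab_gamma i 1 * ((-1) ^ l * real (i choose l) * f l))"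
    by (simp add: ab_alpha_def sum_distrib_left sum_distrib_right algebra_simps)
  also have "\<dots> = (\<Sum>i<k. \<Sum>l\<le>i. ab_gamma i 1 * ((-1) ^ l * real (i choose l) * f l))"
    by (rule sum_triangle_swap)
  finally show ?thesis by (simp add: backward_diff_def sum_distrib_left)
qed

text \<open>gamma_i(1) is the integral of tilde gamma_i over [0,1].\<close>
lemma ab_gamma_tilde_has_integral: "(ab_gamma_tilde i has_integral ab_gamma i 1) {0..1}"
proof -
  have "poly (tilde_gamma_poly i) integrable_on {0..1}"
    by (intro integrable_continuous_interval continuous_on_poly continuous_on_id)
  moreover have "poly (tilde_gamma_poly i) = ab_gamma_tilde i"
    by (rule ext) (simp add: poly_tilde_gamma_poly)
  ultimately have "(ab_gamma_tilde i has_integral integral {0..1} (ab_gamma_tilde i)) {0..1}"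
    by (simp add: integrable_integral)
  moreover have "integral {0..1} (ab_gamma_tilde i) = ab_gamma i 1"
    unfolding ab_gamma_tilde_def ab_gamma_def by (simp add: integral_mult_right)
  ultimately show ?thesis by simp
qed

text \<open>The Adams--Bashforth weights integrate polynomials of degree < k exactly.\<close>
lemma ab_exact_on_polys:
  assumes "degree q < k"
  shows "(\<Sum>l<k. ab_alpha k l * poly q (- real l)) = integral {0..1} (poly q)"
proof -
  let ?d = "backward_diff (\<lambda>l. poly q (- real l))"
  have "((\<lambda>s. \<Sum>i<k. ab_gamma_tilde i s * ?d i) has_integral (\<Sum>i<k. ab_gamma i 1 * ?d i)) {0..1}"
    by (intro has_integral_sum has_integral_mult_left ab_gamma_tilde_has_integral) simp
  moreover have "(\<lambda>s. \<Sum>i<k. ab_gamma_tilde i s * ?d i) = poly q"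
    using newton_backward_interpolation[OF assms] by auto
  ultimately show ?thesis
    by (simp add: ab_sum_backward_diff integral_unique)
qed

text \<open>The LTS weights beta_{m,l}, applied to the values of a polynomial of
  degree < k at the coarse nodes, give the alpha-weighted values at the fine
  nodes (m - i)/p.\<close>
lemma lts_beta_on_polys:
  assumes "degree q < k"
  shows "(\<Sum>l<k. lts_beta k p m l * poly q (- real l))
       = (\<Sum>i<k. ab_alpha k i * poly q ((real m - real i) / real p))"
proof -
  let ?f = "\<lambda>l. poly q (- real l)"
  let ?\<xi> = "\<lambda>i. (real m - real i) / real p"
  let ?c = "\<lambda>i l j. ab_gamma_tilde j (?\<xi> i) * ((-1) ^ l * real (j choose l) * ?f l)"
  have "(\<Sum>l<k. lts_beta k p m l * ?f l) = (\<Sum>l<k. \<Sum>i<k. ab_alpha k i * (\<Sum>j = l..<k. ?c i l j))"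
    by (simp add: lts_beta_def sum_distrib_left sum_distrib_right mult_ac)
  also have "\<dots> = (\<Sum>i<k. \<Sum>l<k. ab_alpha k i * (\<Sum>j = l..<k. ?c i l j))"
    by (rule sum.swap)
  also have "\<dots> = (\<Sum>i<k. ab_alpha k i * (\<Sum>l<k. \<Sum>j = l..<k. ?c i l j))"
    by (simp add: sum_distrib_left)
  also have "\<dots> = (\<Sum>i<k. ab_alpha k i * (\<Sum>j<k. ab_gamma_tilde j (?\<xi> i) * backward_diff ?f j))"
    by (simp only: sum_triangle_swap) (simp add: backward_diff_def sum_distrib_left)
  also have "\<dots> = (\<Sum>i<k. ab_alpha k i * poly q (?\<xi> i))"
    using newton_backward_interpolation[OF assms] by simp
  finally show ?thesis .
qed

text \<open>The integral of (x + s)^r over s in [0,1].\<close>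
lemma integral_shifted_power:
  "integral {0..1} (\<lambda>s. (x + s) ^ r) = ((x + 1) ^ Suc r - x ^ Suc r) / real (Suc r)"
proof -
  have "((\<lambda>s. (x + s) ^ r) has_integral
        ((\<lambda>s. (x + s) ^ Suc r / real (Suc r)) 1 - (\<lambda>s. (x + s) ^ Suc r / real (Suc r)) 0)) {0..1}"
  proof (rule fundamental_theorem_of_calculus)
    fix s :: real
    have e: "(x + s) ^ r + real r * (x + s) ^ (r - Suc 0) * (x + s) = real (Suc r) * (x + s) ^ r"
      by (cases r) (simp_all add: algebra_simps)
    have "((\<lambda>s. (x + s) ^ Suc r / real (Suc r)) has_real_derivative (x + s) ^ r) (at s within {0..1})"
      by (auto intro!: derivative_eq_intros simp del: of_nat_Suc simp add: e)
    then show "((\<lambda>s. (x + s) ^ Suc r / real (Suc r)) has_vector_derivative (x + s) ^ r) (at s within {0..1})"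
      by (simp add: has_real_derivative_iff_has_vector_derivative)
  qed simp
  then show ?thesis by (simp add: integral_unique diff_divide_distrib add.commute)
qed

text \<open>Exactness on monomials, in the form used for the Taylor expansion: the
  alpha-rule integrates s^r over [m, m+1] from the nodes m - l, and the beta-rule
  does the same from the coarse nodes -l p (both in units of dt/p).\<close>
lemma ab_exact_power:
  assumes "r < k"
  shows "(\<Sum>l<k. ab_alpha k l * (x - real l) ^ r) = ((x + 1) ^ Suc r - x ^ Suc r) / real (Suc r)"
proof -
  have "degree ([:x, 1:] ^ r) < k" using assms by (simp add: degree_linear_power)
  moreover have "poly ([:x, 1:] ^ r) = (\<lambda>s. (x + s) ^ r)" by (rule ext) simp
  ultimately show ?thesis
    using ab_exact_on_polys[of "[:x, 1:] ^ r" k] by (simp add: integral_shifted_power)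
qed

lemma lts_beta_exact_power:
  assumes "r < k" "p \<ge> 1"
  shows "(\<Sum>l<k. lts_beta k p m l * (- real l * real p) ^ r)
       = ((real m + 1) ^ Suc r - real m ^ Suc r) / real (Suc r)"
proof -
  have "degree ([:0, real p:] ^ r) \<le> degree [:0, real p:] * r" by (rule degree_power_le)
  also have "\<dots> \<le> r" by (simp add: degree_pCons_eq_if)
  finally have "degree ([:0, real p:] ^ r) \<le> r" .
  then have "degree ([:0, real p:] ^ r) < k" using assms(1) by simp
  from lts_beta_on_polys[OF this, of p m] assms(2)
  have "(\<Sum>l<k. lts_beta k p m l * (- real l * real p) ^ r) = (\<Sum>i<k. ab_alpha k i * (real m - real i) ^ r)"
    by (simp add: mult_ac)
  then show ?thesis using ab_exact_power[OF assms(1)] by simp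
qed


section \<open>Taylor expansion of the solution of y' = B y\<close>

text \<open>The Taylor polynomial of degree n - 1 of the solution through v.\<close>
definition taylor_poly :: "real^'n^'n \<Rightarrow> nat \<Rightarrow> real^'n \<Rightarrow> real \<Rightarrow> real^'n" where
  "taylor_poly B n v s = (\<Sum>r<n. (s ^ r / fact r) *\<^sub>R (((*v) B ^^ r) v))"

text \<open>Its integral from a to b, for the Taylor polynomial of degree k - 1.\<close>
definition taylor_integral :: "real^'n^'n \<Rightarrow> nat \<Rightarrow> real^'n \<Rightarrow> real \<Rightarrow> real \<Rightarrow> real^'n" where
  "taylor_integral B k v a b = (\<Sum>r<k. ((b ^ Suc r - a ^ Suc r) / fact (Suc r)) *\<^sub>R (((*v) B ^^ r) v))"

text \<open>Matrix-vector multiplication commutes with finite sums.\<close>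
lemma matrix_vector_mult_sum: "(A::real^'n^'m) *v sum f S = (\<Sum>x\<in>S. A *v f x)"
  by (induction S rule: infinite_finite_induct) (simp_all add: matrix_vector_right_distrib)

text \<open>The Taylor polynomial passes through the initial value.\<close>
lemma taylor_poly_0: "taylor_poly B (Suc n) v 0 = v"
  unfolding taylor_poly_def by (subst sum.lessThan_Suc_shift) simp

text \<open>Differentiating the Taylor polynomial lowers its degree and applies B.\<close>
lemma taylor_poly_has_derivative:
  "(taylor_poly B (Suc n) v has_vector_derivative (B *v taylor_poly B n v s)) (at s)"
proof -
  have "(taylor_poly B (Suc n) v has_vector_derivative
        (\<Sum>r<Suc n. (real r * s ^ (r - 1) / fact r) *\<^sub>R (((*v) B ^^ r) v))) (at s)"
    unfolding taylor_poly_def[abs_def] by (intro has_vector_derivative_sum) (auto intro!: derivative_eq_intros)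
  moreover have "(\<Sum>r<Suc n. (real r * s ^ (r - 1) / fact r) *\<^sub>R (((*v) B ^^ r) v))
               = (\<Sum>r<n. (s ^ r / fact r) *\<^sub>R (B *v (((*v) B ^^ r) v)))"
    by (subst sum.lessThan_Suc_shift) (simp add: fact_Suc)
  ultimately show ?thesis
    by (simp add: taylor_poly_def matrix_vector_mult_sum matrix_vector_mult_scaleR)
qed

text \<open>Increments of the Taylor polynomial of degree k are B times the integral
  of the Taylor polynomial of degree k - 1.\<close>
lemma taylor_poly_increment:
  "taylor_poly B (Suc k) v b - taylor_poly B (Suc k) v a = B *v taylor_integral B k v a b"
proof -
  have shift: "taylor_poly B (Suc k) v x = v + (\<Sum>r<k. (x ^ Suc r / fact (Suc r)) *\<^sub>R (B *v (((*v) B ^^ r) v)))" for x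
    unfolding taylor_poly_def by (subst sum.lessThan_Suc_shift) simp
  show ?thesis
    by (simp add: shift taylor_integral_def matrix_vector_mult_sum matrix_vector_mult_diff_distrib
        matrix_vector_mult_scaleR diff_divide_distrib scaleR_diff_left sum_subtractf)
qed

text \<open>The remainder y(t0 + s) - taylor_poly (y t0) s solves the same equation with
  the lower-order remainder as right-hand side.\<close>
lemma taylor_remainder_has_derivative:
  assumes deriv: "\<forall>t. (y has_vector_derivative (B *v y t)) (at t)"
  shows "((\<lambda>\<sigma>. y (t0 + \<sigma>) - taylor_poly B (Suc n) (y t0) \<sigma>) has_vector_derivative
           (B *v (y (t0 + \<sigma>) - taylor_poly B n (y t0) \<sigma>))) (at \<sigma>)"
proof -
  have "((\<lambda>\<sigma>. t0 + \<sigma>) has_vector_derivative 1) (at \<sigma>)"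
    by (auto intro!: derivative_eq_intros)
  from vector_diff_chain_at[OF this, of y "B *v y (t0 + \<sigma>)"] deriv
  have "((\<lambda>\<sigma>. y (t0 + \<sigma>)) has_vector_derivative B *v y (t0 + \<sigma>)) (at \<sigma>)" by (simp add: o_def)
  from has_vector_derivative_diff[OF this taylor_poly_has_derivative]
  show ?thesis by (simp add: matrix_vector_mult_diff_distrib)
qed

text \<open>The operator norm of a matrix bounds its action on vectors.\<close>
lemma norm_matrix_vector_le: "norm (A *v x) \<le> onorm ((*v) A) * norm x" "0 \<le> onorm ((*v) (A::real^'n^'m))"
  by (intro onorm onorm_pos_le matrix_vector_mul_bounded_linear)+

text \<open>Mean value inequality on the segment between 0 and s.\<close>
lemma mean_value_bound:
  fixes g g' :: "real \<Rightarrow> 'a::real_normed_vector"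
  assumes deriv: "\<And>x. (g has_vector_derivative g' x) (at x)"
    and bound: "\<And>x. \<bar>x\<bar> \<le> \<bar>s\<bar> \<Longrightarrow> norm (g' x) \<le> M"
  shows "norm (g s - g 0) \<le> M * \<bar>s\<bar>"
proof -
  have "norm (g s - g 0) \<le> M * norm (s - 0)"
  proof (rule differentiable_bound[of "closed_segment 0 s"])
    fix x assume x: "x \<in> closed_segment 0 s"
    show "(g has_derivative (\<lambda>h. h *\<^sub>R g' x)) (at x within closed_segment 0 s)"
      using deriv[of x] by (simp add: has_vector_derivative_def has_derivative_at_withinI)
    have "\<bar>x\<bar> \<le> \<bar>s\<bar>" using x by (auto simp: closed_segment_eq_real_ivl split: if_splits)
    then show "onorm (\<lambda>h. h *\<^sub>R g' x) \<le> M"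
      using bound onorm_scaleR_left[OF bounded_linear_ident, of "g' x"] by (simp add: onorm_id)
  qed auto
  then show ?thesis by simp
qed

text \<open>Taylor's theorem for the solution, uniformly for base points in [-T, T]
  and steps |s| <= S.  The induction on the degree applies the mean value
  inequality to the remainder, whose derivative is B times the previous remainder.\<close>
lemma taylor_bound:
  fixes B :: "real^'n^'n" and y :: "real \<Rightarrow> real^'n"
  assumes deriv: "\<forall>t. (y has_vector_derivative (B *v y t)) (at t)"
  shows "\<exists>K\<ge>0. \<forall>t0 s. \<bar>t0\<bar> \<le> T \<longrightarrow> \<bar>s\<bar> \<le> S \<longrightarrow>
           norm (y (t0 + s) - taylor_poly B n (y t0) s) \<le> K * \<bar>s\<bar> ^ n"
proof (induction n)
  case 0
  have "continuous_on {-T-S..T+S} y"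
    using deriv by (meson continuous_at_imp_continuous_on has_vector_derivative_continuous)
  then have "bounded (y ` {-T-S..T+S})" by (intro compact_imp_bounded compact_continuous_image) auto
  then obtain K where K: "K > 0" "\<And>x. x \<in> y ` {-T-S..T+S} \<Longrightarrow> norm x \<le> K"
    by (auto simp: bounded_pos)
  have "norm (y (t0 + s) - taylor_poly B 0 (y t0) s) \<le> K * \<bar>s\<bar> ^ 0"
    if "\<bar>t0\<bar> \<le> T" "\<bar>s\<bar> \<le> S" for t0 s
  proof -
    have "t0 + s \<in> {-T-S..T+S}" using that by auto
    then show ?thesis using K(2) by (simp add: taylor_poly_def)
  qed
  then show ?case using K(1) by (intro exI[of _ K]) auto
next
  case (Suc n)
  then obtain K where K0: "K \<ge> 0" and K: "\<And>t0 s. \<bar>t0\<bar> \<le> T \<Longrightarrow> \<bar>s\<bar> \<le> S \<Longrightarrow>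
      norm (y (t0 + s) - taylor_poly B n (y t0) s) \<le> K * \<bar>s\<bar> ^ n"
    by blast
  define KB where "KB = onorm ((*v) B)"
  have KB0: "KB \<ge> 0" unfolding KB_def by (rule norm_matrix_vector_le(2))
  have "norm (y (t0 + s) - taylor_poly B (Suc n) (y t0) s) \<le> KB * K * \<bar>s\<bar> ^ Suc n"
    if t0: "\<bar>t0\<bar> \<le> T" and s: "\<bar>s\<bar> \<le> S" for t0 s
  proof -
    have "norm ((y (t0 + s) - taylor_poly B (Suc n) (y t0) s) - (y (t0 + 0) - taylor_poly B (Suc n) (y t0) 0))
        \<le> KB * (K * \<bar>s\<bar> ^ n) * \<bar>s\<bar>"
    proof (rule mean_value_bound[OF taylor_remainder_has_derivative[OF deriv]])
      fix x assume ax: "\<bar>x\<bar> \<le> \<bar>s\<bar>"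
      have "norm (B *v (y (t0 + x) - taylor_poly B n (y t0) x)) \<le> KB * norm (y (t0 + x) - taylor_poly B n (y t0) x)"
        unfolding KB_def by (rule norm_matrix_vector_le(1))
      also have "\<dots> \<le> KB * (K * \<bar>x\<bar> ^ n)"
        using K[OF t0, of x] ax s KB0 by (intro mult_left_mono) auto
      also have "\<dots> \<le> KB * (K * \<bar>s\<bar> ^ n)"
        using ax K0 KB0 by (intro mult_left_mono power_mono) auto
      finally show "norm (B *v (y (t0 + x) - taylor_poly B n (y t0) x)) \<le> KB * (K * \<bar>s\<bar> ^ n)" .
    qed
    then show ?thesis by (simp add: taylor_poly_0 mult_ac)
  qed
  then show ?case using KB0 K0 by (intro exI[of _ "KB * K"]) auto
qed


section \<open>Local defect of one substep\<close>

text \<open>A weighted sum of vectors of norm at most M has norm at most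
  (sum of |weights|) M.\<close>
lemma norm_weighted_sum_le:
  fixes E :: "nat \<Rightarrow> 'a::real_normed_vector"
  assumes "\<And>l. l < k \<Longrightarrow> norm (E l) \<le> M"
  shows "norm (h *\<^sub>R (\<Sum>l<k. w l *\<^sub>R E l)) \<le> \<bar>h\<bar> * ((\<Sum>l<k. \<bar>w l\<bar>) * M)"
proof -
  have "norm (\<Sum>l<k. w l *\<^sub>R E l) \<le> (\<Sum>l<k. norm (w l *\<^sub>R E l))" by (rule norm_sum)
  also have "\<dots> \<le> (\<Sum>l<k. \<bar>w l\<bar> * M)"
    using assms by (intro sum_mono) (simp add: mult_left_mono)
  finally show ?thesis by (simp add: sum_distrib_right mult_left_mono)
qed

text \<open>A rule with weights w and nodes c l * h that integrates s^r (r < k) exactly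
  over [a, b] integrates the Taylor polynomial of degree k - 1 exactly over
  [a h, b h].\<close>
lemma weighted_taylor_sum:
  assumes exact: "\<And>r. r < k \<Longrightarrow> (\<Sum>l<k. w l * c l ^ r) = (b ^ Suc r - a ^ Suc r) / real (Suc r)"
  shows "h *\<^sub>R (\<Sum>l<k. w l *\<^sub>R taylor_poly B k v (c l * h)) = taylor_integral B k v (a * h) (b * h)"
proof -
  have coeff: "h * (\<Sum>l<k. w l * ((c l * h) ^ r / fact r)) = ((b * h) ^ Suc r - (a * h) ^ Suc r) / fact (Suc r)"
    if "r < k" for r
  proof -
    have "h * (\<Sum>l<k. w l * ((c l * h) ^ r / fact r)) = (\<Sum>l<k. w l * c l ^ r) * (h ^ Suc r / fact r)"
      by (simp add: sum_distrib_left sum_distrib_right power_mult_distrib mult_ac)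
    then show ?thesis
      using exact[OF that] by (simp add: power_mult_distrib fact_Suc field_simps del: of_nat_Suc)
  qed
  have "(\<Sum>l<k. w l *\<^sub>R taylor_poly B k v (c l * h))
      = (\<Sum>l<k. \<Sum>r<k. (w l * ((c l * h) ^ r / fact r)) *\<^sub>R (((*v) B ^^ r) v))"
    by (simp add: taylor_poly_def scaleR_sum_right)
  also have "\<dots> = (\<Sum>r<k. (\<Sum>l<k. w l * ((c l * h) ^ r / fact r)) *\<^sub>R (((*v) B ^^ r) v))"
    by (subst sum.swap) (simp add: scaleR_sum_left)
  finally have "h *\<^sub>R (\<Sum>l<k. w l *\<^sub>R taylor_poly B k v (c l * h))
      = (\<Sum>r<k. (h * (\<Sum>l<k. w l * ((c l * h) ^ r / fact r))) *\<^sub>R (((*v) B ^^ r) v))"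
    by (simp add: scaleR_sum_right)
  also have "\<dots> = taylor_integral B k v (a * h) (b * h)"
    unfolding taylor_integral_def using coeff by (intro sum.cong refl) simp
  finally show ?thesis .
qed

text \<open>Hence such a rule applied to the solution has error controlled by the
  Taylor remainder at the nodes.\<close>
lemma quadrature_error:
  fixes y :: "real \<Rightarrow> real^'n"
  assumes exact: "\<And>r. r < k \<Longrightarrow> (\<Sum>l<k. w l * c l ^ r) = (b ^ Suc r - a ^ Suc r) / real (Suc r)"
    and taylor: "\<And>s. \<bar>s\<bar> \<le> R \<Longrightarrow> norm (y (t + s) - taylor_poly B k (y t) s) \<le> K * \<bar>s\<bar> ^ k"
    and nodes: "\<And>l. l < k \<Longrightarrow> \<bar>c l * h\<bar> \<le> R" and K0: "K \<ge> 0"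
  shows "norm (h *\<^sub>R (\<Sum>l<k. w l *\<^sub>R y (t + c l * h)) - taylor_integral B k (y t) (a * h) (b * h))
         \<le> \<bar>h\<bar> * ((\<Sum>l<k. \<bar>w l\<bar>) * (K * R ^ k))"
proof -
  define E where "E s = y (t + s) - taylor_poly B k (y t) s" for s
  have taylor_exact: "h *\<^sub>R (\<Sum>l<k. w l *\<^sub>R taylor_poly B k (y t) (c l * h))
      = taylor_integral B k (y t) (a * h) (b * h)"
    by (rule weighted_taylor_sum[OF exact])
  have "h *\<^sub>R (\<Sum>l<k. w l *\<^sub>R y (t + c l * h)) - taylor_integral B k (y t) (a * h) (b * h)
      = h *\<^sub>R (\<Sum>l<k. w l *\<^sub>R E (c l * h))"
    by (simp add: E_def scaleR_diff_right sum_subtractf taylor_exact)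
  also have "norm \<dots> \<le> \<bar>h\<bar> * ((\<Sum>l<k. \<bar>w l\<bar>) * (K * R ^ k))"
  proof (rule norm_weighted_sum_le)
    fix l assume "l < k"
    then have "\<bar>c l * h\<bar> \<le> R" by (rule nodes)
    then show "norm (E (c l * h)) \<le> K * R ^ k"
      using taylor[of "c l * h"] K0 unfolding E_def
      by (meson abs_ge_zero mult_left_mono order_trans power_mono)
  qed
  finally show ?thesis .
qed

text \<open>The increment of the solution is B times the integral of its Taylor
  polynomial, up to the remainder of order k + 1.\<close>
lemma increment_error:
  fixes y :: "real \<Rightarrow> real^'n"
  assumes taylor: "\<And>s. \<bar>s\<bar> \<le> R \<Longrightarrow> norm (y (t + s) - taylor_poly B (Suc k) (y t) s) \<le> K * \<bar>s\<bar> ^ Suc k"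
    and "\<bar>a\<bar> \<le> R" "\<bar>b\<bar> \<le> R" and K0: "K \<ge> 0"
  shows "norm (y (t + b) - y (t + a) - B *v taylor_integral B k (y t) a b) \<le> 2 * K * R ^ Suc k"
proof -
  have rem: "norm (y (t + s) - taylor_poly B (Suc k) (y t) s) \<le> K * R ^ Suc k" if "\<bar>s\<bar> \<le> R" for s
    using taylor[OF that] that K0 by (meson abs_ge_zero mult_left_mono order_trans power_mono)
  have "y (t + b) - y (t + a) - B *v taylor_integral B k (y t) a b
      = (y (t + b) - taylor_poly B (Suc k) (y t) b) - (y (t + a) - taylor_poly B (Suc k) (y t) a)"
    by (simp add: taylor_poly_increment[symmetric])
  also have "norm \<dots> \<le> K * R ^ Suc k + K * R ^ Suc k"
    using rem[OF assms(2)] rem[OF assms(3)] norm_triangle_ineq4 by (blast intro: order_trans add_mono)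
  finally show ?thesis by simp
qed

text \<open>The defect of substep m (m = 0, ..., p-1) of the LTS scheme on the exact
  solution, with h = dt / p: both the coarse part B (I - P) and the fine part B P
  are evaluated on exact data.\<close>
definition substep_defect ::
    "nat \<Rightarrow> nat \<Rightarrow> real^'n^'n \<Rightarrow> real^'n^'n \<Rightarrow> (real \<Rightarrow> real^'n) \<Rightarrow> real \<Rightarrow> real \<Rightarrow> nat \<Rightarrow> real^'n" where
  "substep_defect k p B P y tn dt m =
     (dt / real p) *\<^sub>R ((B ** (mat 1 - P)) *v (\<Sum>l<k. lts_beta k p m l *\<^sub>R y (tn - real l * dt)))
   + (dt / real p) *\<^sub>R ((B ** P) *v (\<Sum>l<k. ab_alpha k l *\<^sub>R y (tn + (real m - real l) * (dt / real p))))
   - (y (tn + (real m + 1) * (dt / real p)) - y (tn + real m * (dt / real p)))"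

text \<open>Splitting the defect around any common approximation Q of the two weighted
  sums: because B (I - P) + B P = B, the approximation cancels.\<close>
lemma substep_defect_split:
  fixes B P :: "real^'n^'n" and y :: "real \<Rightarrow> real^'n" and Q :: "real^'n" and dt :: real and p :: nat
  defines "h \<equiv> dt / real p"
  shows "substep_defect k p B P y tn dt m =
      (B ** (mat 1 - P)) *v (h *\<^sub>R (\<Sum>l<k. lts_beta k p m l *\<^sub>R y (tn - real l * dt)) - Q)
    + (B ** P) *v (h *\<^sub>R (\<Sum>l<k. ab_alpha k l *\<^sub>R y (tn + (real m - real l) * h)) - Q)
    - (y (tn + (real m + 1) * h) - y (tn + real m * h) - B *v Q)"
proof -
  have split: "B *v Q = (B ** (mat 1 - P)) *v Q + (B ** P) *v Q"
    by (simp add: matrix_vector_mul_assoc[symmetric] matrix_vector_mult_diff_rdistrib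
        matrix_vector_mult_diff_distrib)
  show ?thesis
    unfolding substep_defect_def h_def[symmetric]
    by (simp add: split matrix_vector_mult_diff_distrib matrix_vector_mult_scaleR algebra_simps)
qed

text \<open>The defect estimate for a fixed t_n and dt, given Taylor bounds of orders
  k and k + 1 on the window |s| <= (p + k) dt, which contains all nodes.\<close>
lemma substep_defect_estimate:
  fixes B P :: "real^'n^'n" and y :: "real \<Rightarrow> real^'n"
  assumes taylor_k: "\<And>s. \<bar>s\<bar> \<le> real (p + k) * dt \<Longrightarrow> norm (y (tn + s) - taylor_poly B k (y tn) s) \<le> K1 * \<bar>s\<bar> ^ k"
    and taylor_Suc_k: "\<And>s. \<bar>s\<bar> \<le> real (p + k) * dt \<Longrightarrow> norm (y (tn + s) - taylor_poly B (Suc k) (y tn) s) \<le> K2 * \<bar>s\<bar> ^ Suc k"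
    and K0: "K1 \<ge> 0" "K2 \<ge> 0"
    and p1: "p \<ge> 1" and mp: "m < p" and dt0: "0 < dt"
  shows "norm (substep_defect k p B P y tn dt m)
      \<le> onorm ((*v) (B ** (mat 1 - P))) * (dt * ((\<Sum>l<k. \<bar>lts_beta k p m l\<bar>) * (K1 * (real (p + k) * dt) ^ k)))
       + onorm ((*v) (B ** P)) * (dt * ((\<Sum>l<k. \<bar>ab_alpha k l\<bar>) * (K1 * (real (p + k) * dt) ^ k)))
       + 2 * K2 * (real (p + k) * dt) ^ Suc k"
proof -
  define h where "h = dt / real p"
  have h0: "0 < h" and hdt: "h \<le> dt" and dth: "dt = real p * h"
    using dt0 p1 by (auto simp: h_def field_simps)
  define Q where "Q = taylor_integral B k (y tn) (real m * h) ((real m + 1) * h)"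
  let ?X = "\<lambda>w. dt * ((\<Sum>l<k. \<bar>w l\<bar>) * (K1 * (real (p + k) * dt) ^ k))"
  have "\<bar>h\<bar> * ((\<Sum>l<k. \<bar>w l\<bar>) * (K1 * (real (p + k) * dt) ^ k)) \<le> ?X w" for w :: "nat \<Rightarrow> real"
    using h0 hdt K0 dt0 by (intro mult_right_mono) (auto intro!: mult_nonneg_nonneg sum_nonneg)
  note scale = order_trans[OF _ this]
  have beta: "norm (h *\<^sub>R (\<Sum>l<k. lts_beta k p m l *\<^sub>R y (tn - real l * dt)) - Q) \<le> ?X (lts_beta k p m)"
  proof -
    have "tn + (- real l * real p) * h = tn - real l * dt" for l by (simp add: dth)
    moreover have "norm (h *\<^sub>R (\<Sum>l<k. lts_beta k p m l *\<^sub>R y (tn + (- real l * real p) * h)) - Q)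
        \<le> \<bar>h\<bar> * ((\<Sum>l<k. \<bar>lts_beta k p m l\<bar>) * (K1 * (real (p + k) * dt) ^ k))"
      unfolding Q_def
    proof (rule quadrature_error[OF lts_beta_exact_power[OF _ p1] taylor_k _ K0(1)])
      fix l assume "l < k"
      then have "real l * dt \<le> real (p + k) * dt" using dt0 by (intro mult_right_mono) auto
      then show "\<bar>(- real l * real p) * h\<bar> \<le> real (p + k) * dt" using h0 by (simp add: dth abs_mult)
    qed
    ultimately show ?thesis by (simp only:) (rule scale)
  qed
  have alpha: "norm (h *\<^sub>R (\<Sum>l<k. ab_alpha k l *\<^sub>R y (tn + (real m - real l) * h)) - Q) \<le> ?X (ab_alpha k)"
    unfolding Q_def
  proof (rule scale, rule quadrature_error[OF ab_exact_power taylor_k _ K0(1)])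
    fix l assume "l < k"
    then have "\<bar>real m - real l\<bar> \<le> real (p + k)" using mp by auto
    then have "\<bar>real m - real l\<bar> * h \<le> real (p + k) * dt"
      using h0 hdt by (intro mult_mono) auto
    then show "\<bar>(real m - real l) * h\<bar> \<le> real (p + k) * dt" using h0 by (simp add: abs_mult)
  qed
  have incr: "norm (y (tn + (real m + 1) * h) - y (tn + real m * h) - B *v Q) \<le> 2 * K2 * (real (p + k) * dt) ^ Suc k"
    unfolding Q_def
  proof (rule increment_error[OF taylor_Suc_k _ _ K0(2)])
    have "0 \<le> real m * h" "real m * h \<le> (real m + 1) * h" "(real m + 1) * h \<le> dt" "dt \<le> real (p + k) * dt"
      using mp h0 dt0 by (auto simp: dth mult_right_mono)
    then show "\<bar>real m * h\<bar> \<le> real (p + k) * dt" "\<bar>(real m + 1) * h\<bar> \<le> real (p + k) * dt" by auto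
  qed
  have tri: "norm (a + b - c) \<le> norm a + norm b + norm c" for a b c :: "real^'n"
    using norm_triangle_ineq4[of "a + b" c] norm_triangle_ineq[of a b] by linarith
  have operator: "norm (A *v x) \<le> onorm ((*v) A) * X" if "norm x \<le> X" for A :: "real^'n^'n" and x X
    using norm_matrix_vector_le(1)[of A x] mult_left_mono[OF that norm_matrix_vector_le(2)[of A]] by linarith
  show ?thesis
    unfolding substep_defect_split[where Q = Q] h_def[symmetric]
    using tri operator[OF beta] operator[OF alpha] incr by (meson add_mono order_trans)
qed

text \<open>Each substep has defect O(dt^(k+1)), uniformly for |t_n| <= T.\<close>
lemma substep_defect_bound:
  fixes B P :: "real^'n^'n" and y :: "real \<Rightarrow> real^'n"
  assumes deriv: "\<forall>t. (y has_vector_derivative (B *v y t)) (at t)"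
    and p1: "p \<ge> 1" and mp: "m < p"
  shows "\<exists>C. \<forall>tn dt. \<bar>tn\<bar> \<le> T \<longrightarrow> 0 < dt \<longrightarrow> dt \<le> 1 \<longrightarrow>
           norm (substep_defect k p B P y tn dt m) \<le> C * dt ^ (k + 1)"
proof -
  let ?S = "real (p + k)"
  obtain K1 where K1: "K1 \<ge> 0" "\<And>t0 s. \<bar>t0\<bar> \<le> T \<Longrightarrow> \<bar>s\<bar> \<le> ?S \<Longrightarrow>
      norm (y (t0 + s) - taylor_poly B k (y t0) s) \<le> K1 * \<bar>s\<bar> ^ k"
    using taylor_bound[OF deriv, of T ?S k] by blast
  obtain K2 where K2: "K2 \<ge> 0" "\<And>t0 s. \<bar>t0\<bar> \<le> T \<Longrightarrow> \<bar>s\<bar> \<le> ?S \<Longrightarrow>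
      norm (y (t0 + s) - taylor_poly B (Suc k) (y t0) s) \<le> K2 * \<bar>s\<bar> ^ Suc k"
    using taylor_bound[OF deriv, of T ?S "Suc k"] by blast
  define C where "C = onorm ((*v) (B ** (mat 1 - P))) * (\<Sum>l<k. \<bar>lts_beta k p m l\<bar>) * K1 * ?S ^ k
    + onorm ((*v) (B ** P)) * (\<Sum>l<k. \<bar>ab_alpha k l\<bar>) * K1 * ?S ^ k + 2 * K2 * ?S ^ Suc k"
  have "norm (substep_defect k p B P y tn dt m) \<le> C * dt ^ (k + 1)"
    if tn: "\<bar>tn\<bar> \<le> T" and dt0: "0 < dt" and dt1: "dt \<le> 1" for tn dt
  proof -
    have window: "\<bar>s\<bar> \<le> ?S" if "\<bar>s\<bar> \<le> ?S * dt" for s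
      using that dt1 mult_left_le[OF dt1, of ?S] by simp
    have "norm (substep_defect k p B P y tn dt m)
      \<le> onorm ((*v) (B ** (mat 1 - P))) * (dt * ((\<Sum>l<k. \<bar>lts_beta k p m l\<bar>) * (K1 * (?S * dt) ^ k)))
       + onorm ((*v) (B ** P)) * (dt * ((\<Sum>l<k. \<bar>ab_alpha k l\<bar>) * (K1 * (?S * dt) ^ k)))
       + 2 * K2 * (?S * dt) ^ Suc k"
      by (rule substep_defect_estimate[OF K1(2)[OF tn window] K2(2)[OF tn window] K1(1) K2(1) p1 mp dt0])
    also have "\<dots> = C * dt ^ (k + 1)"
      unfolding power_mult_distrib by (simp add: C_def algebra_simps)
    finally show ?thesis .
  qed
  then show ?thesis by blast
qed


section \<open>The stages of the LTS step on exact data\<close>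

text \<open>Later iterations of the stage recursion do not change already computed stages.\<close>
lemma lts_hist_stable:
  "q \<le> int m \<Longrightarrow> m \<le> n \<Longrightarrow> lts_hist k p B P dt yh yin n q = lts_hist k p B P dt yh yin m q"
proof (induction n)
  case (Suc n)
  then show ?case by (cases "m = Suc n") (auto simp: Let_def)
qed simp

text \<open>The stages tilde y_{q/p}, q <= p, computed from exact inputs.\<close>
definition stage ::
    "nat \<Rightarrow> nat \<Rightarrow> real^'n^'n \<Rightarrow> real^'n^'n \<Rightarrow> (real \<Rightarrow> real^'n) \<Rightarrow> real \<Rightarrow> real \<Rightarrow> int \<Rightarrow> real^'n" where
  "stage k p B P y tn dt =
     lts_hist k p B P dt (\<lambda>l. y (tn - real l * dt)) (\<lambda>j. P *v y (tn - real j * dt / real p)) p"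

text \<open>The error of stage j, compared with the solution at t_n + j dt / p.\<close>
definition stage_err ::
    "nat \<Rightarrow> nat \<Rightarrow> real^'n^'n \<Rightarrow> real^'n^'n \<Rightarrow> (real \<Rightarrow> real^'n) \<Rightarrow> real \<Rightarrow> real \<Rightarrow> nat \<Rightarrow> real^'n" where
  "stage_err k p B P y tn dt j = stage k p B P y tn dt (int j) - y (tn + real j * (dt / real p))"

text \<open>Stages with non-positive index are the given inputs.\<close>
lemma stage_input:
  assumes "q \<le> 0"
  shows "stage k p B P y tn dt q = (if q = 0 then y tn else P *v y (tn + real_of_int q * (dt / real p)))"
proof -
  have "stage k p B P y tn dt q = lts_hist k p B P dt (\<lambda>l. y (tn - real l * dt))
          (\<lambda>j. P *v y (tn - real j * dt / real p)) 0 q"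
    unfolding stage_def using assms by (intro lts_hist_stable) auto
  then show ?thesis using assms by (simp add: algebra_simps)
qed

text \<open>The recursion of the scheme, restated for the stages.\<close>
lemma stage_step:
  assumes "m < p"
  shows "stage k p B P y tn dt (int (Suc m)) = stage k p B P y tn dt (int m)
     + (dt / real p) *\<^sub>R ((B ** (mat 1 - P)) *v (\<Sum>l<k. lts_beta k p m l *\<^sub>R y (tn - real l * dt)))
     + (dt / real p) *\<^sub>R ((B ** P) *v (\<Sum>l<k. ab_alpha k l *\<^sub>R stage k p B P y tn dt (int m - int l)))"
proof -
  let ?H = "lts_hist k p B P dt (\<lambda>l. y (tn - real l * dt)) (\<lambda>j. P *v y (tn - real j * dt / real p))"
  have now: "stage k p B P y tn dt (int (Suc m)) = ?H (Suc m) (int (Suc m))"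
    unfolding stage_def using assms by (intro lts_hist_stable) auto
  have cur: "stage k p B P y tn dt (int m) = ?H m (int m)"
    unfolding stage_def using assms by (intro lts_hist_stable) auto
  have past: "stage k p B P y tn dt (int m - int l) = ?H m (int m - int l)" for l
    unfolding stage_def using assms by (intro lts_hist_stable) auto
  show ?thesis unfolding now cur past by (simp add: Let_def)
qed

text \<open>A diagonal 0/1 matrix is a projection.\<close>
lemma projection_idempotent:
  fixes P :: "real^'n^'n"
  assumes "\<forall>i j. i \<noteq> j \<longrightarrow> P $ i $ j = 0" "\<forall>i. P $ i $ i = 0 \<or> P $ i $ i = 1"
  shows "P ** P = P"
proof -
  have "(P ** P) $ i $ j = P $ i $ j" for i j
  proof -
    have "(P ** P) $ i $ j = (\<Sum>l\<in>UNIV. P $ i $ l * P $ l $ j)"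
      by (simp add: matrix_matrix_mult_def)
    also have "\<dots> = (\<Sum>l\<in>UNIV. if l = i then P $ i $ i * P $ i $ j else 0)"
      using assms(1) by (intro sum.cong refl) auto
    also have "\<dots> = P $ i $ j" using assms by (cases "i = j") auto
    finally show ?thesis .
  qed
  then show ?thesis by (simp add: vec_eq_iff)
qed

text \<open>The error of stage m+1 is the error of stage m plus the substep defect plus
  the propagated errors of the earlier stages.  For indices l > m these are
  errors of the inputs P y(t), which are annihilated by B P since P is a
  projection; so only errors of the computed stages 0..m contribute.\<close>
lemma stage_err_step:
  fixes B P :: "real^'n^'n" and y :: "real \<Rightarrow> real^'n" and tn dt :: real and k :: nat
  assumes proj: "P ** P = P" and mp: "m < p"
  defines "d \<equiv> \<lambda>l. (B ** P) *v (stage k p B P y tn dt (int m - int l)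
                                 - y (tn + (real m - real l) * (dt / real p)))"
  shows "stage_err k p B P y tn dt (Suc m) = stage_err k p B P y tn dt m
           + substep_defect k p B P y tn dt m + (dt / real p) *\<^sub>R (\<Sum>l<k. ab_alpha k l *\<^sub>R d l)"
    and "l \<le> m \<Longrightarrow> d l = (B ** P) *v stage_err k p B P y tn dt (m - l)"
    and "m < l \<Longrightarrow> d l = 0"
proof -
  let ?S = "\<lambda>x. (B ** P) *v (\<Sum>l<k. ab_alpha k l *\<^sub>R x l)"
  have sum_d: "(\<Sum>l<k. ab_alpha k l *\<^sub>R d l)
      = ?S (\<lambda>l. stage k p B P y tn dt (int m - int l)) - ?S (\<lambda>l. y (tn + (real m - real l) * (dt / real p)))"
    by (simp add: d_def matrix_vector_mult_sum matrix_vector_mult_scaleR matrix_vector_mult_diff_distrib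
        scaleR_diff_right sum_subtractf)
  show "stage_err k p B P y tn dt (Suc m) = stage_err k p B P y tn dt m
          + substep_defect k p B P y tn dt m + (dt / real p) *\<^sub>R (\<Sum>l<k. ab_alpha k l *\<^sub>R d l)"
    unfolding stage_err_def stage_step[OF mp] substep_defect_def sum_d
    by (simp add: scaleR_diff_right algebra_simps)
  show "l \<le> m \<Longrightarrow> d l = (B ** P) *v stage_err k p B P y tn dt (m - l)"
    by (simp add: d_def stage_err_def of_nat_diff)
  assume "m < l"
  then have "stage k p B P y tn dt (int m - int l) = P *v y (tn + (real m - real l) * (dt / real p))"
    by (simp add: stage_input)
  moreover have "(B ** P) *v (P *v x) = (B ** P) *v x" for x
    by (simp add: matrix_vector_mul_assoc matrix_mul_assoc[symmetric] proj)
  ultimately show "d l = 0" by (simp add: d_def matrix_vector_mult_diff_distrib)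
qed

text \<open>One step of the error recursion: if the stages 0..m have errors at most E,
  stage m + 1 has error at most E + defect + (sum of |alpha_l|) |B P| E.\<close>
lemma stage_err_propagation:
  fixes B P :: "real^'n^'n" and y :: "real \<Rightarrow> real^'n"
  assumes proj: "P ** P = P" and mp: "m < p" and dt0: "0 < dt" and dt1: "dt \<le> 1"
    and prev: "\<And>j. j \<le> m \<Longrightarrow> norm (stage_err k p B P y tn dt j) \<le> E"
  shows "norm (stage_err k p B P y tn dt (Suc m))
      \<le> E + norm (substep_defect k p B P y tn dt m) + (\<Sum>l<k. \<bar>ab_alpha k l\<bar>) * onorm ((*v) (B ** P)) * E"
proof -
  define KP where "KP = onorm ((*v) (B ** P))"
  define h where "h = dt / real p"
  have KP0: "KP \<ge> 0" unfolding KP_def by (simp add: norm_matrix_vector_le)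
  have E0: "E \<ge> 0" using prev[of 0] norm_ge_zero order_trans by blast
  have h0: "0 \<le> h" and h1: "h \<le> 1" using dt0 dt1 mp by (auto simp: h_def field_simps)
  define d where "d l = (B ** P) *v (stage k p B P y tn dt (int m - int l)
                           - y (tn + (real m - real l) * (dt / real p)))" for l
  note rec = stage_err_step[OF proj mp, where B=B and k=k and y=y and tn=tn and dt=dt, folded d_def]
  have "norm (d l) \<le> KP * E" if "l < k" for l
  proof (cases "l \<le> m")
    case True
    then show ?thesis
      using rec(2)[OF True] norm_matrix_vector_le(1)[of "B ** P"] prev[of "m - l"] KP0
      unfolding KP_def[symmetric] by (metis diff_le_self mult_left_mono order_trans)
  qed (use rec(3) KP0 E0 in simp)
  then have "norm (h *\<^sub>R (\<Sum>l<k. ab_alpha k l *\<^sub>R d l)) \<le> \<bar>h\<bar> * ((\<Sum>l<k. \<bar>ab_alpha k l\<bar>) * (KP * E))"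
    by (rule norm_weighted_sum_le)
  also have "\<dots> \<le> (\<Sum>l<k. \<bar>ab_alpha k l\<bar>) * KP * E"
    using h0 h1 KP0 E0 by (simp add: mult_left_le_one_le sum_nonneg mult.assoc)
  finally have propagated: "norm (h *\<^sub>R (\<Sum>l<k. ab_alpha k l *\<^sub>R d l)) \<le> (\<Sum>l<k. \<bar>ab_alpha k l\<bar>) * KP * E" .
  let ?e = "stage_err k p B P y tn dt m" and ?t = "substep_defect k p B P y tn dt m"
    and ?q = "h *\<^sub>R (\<Sum>l<k. ab_alpha k l *\<^sub>R d l)"
  have "norm (?e + ?t + ?q) \<le> E + norm ?t + (\<Sum>l<k. \<bar>ab_alpha k l\<bar>) * KP * E"
    using prev[OF order_refl] propagated norm_triangle_ineq[of "?e + ?t" ?q] norm_triangle_ineq[of ?e ?t]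
    by linarith
  then show ?thesis unfolding rec(1) h_def[symmetric] KP_def[symmetric] .
qed

text \<open>Induction on the stage index: all stages up to m have error O(dt^(k+1)).\<close>
lemma stage_err_bound:
  fixes B P :: "real^'n^'n" and y :: "real \<Rightarrow> real^'n"
  assumes deriv: "\<forall>t. (y has_vector_derivative (B *v y t)) (at t)"
    and p1: "p \<ge> 1" and proj: "P ** P = P"
  shows "m \<le> p \<Longrightarrow> \<exists>C\<ge>0. \<forall>tn dt j. \<bar>tn\<bar> \<le> T \<longrightarrow> 0 < dt \<longrightarrow> dt \<le> 1 \<longrightarrow> j \<le> m \<longrightarrow>
           norm (stage_err k p B P y tn dt j) \<le> C * dt ^ (k + 1)"
proof (induction m)
  case 0
  show ?case by (intro exI[of _ 0]) (simp add: stage_err_def stage_input)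
next
  case (Suc m)
  then have mp: "m < p" by simp
  from Suc obtain C where C0: "C \<ge> 0" and C: "\<And>tn dt j. \<bar>tn\<bar> \<le> T \<Longrightarrow> 0 < dt \<Longrightarrow> dt \<le> 1 \<Longrightarrow> j \<le> m \<Longrightarrow>
      norm (stage_err k p B P y tn dt j) \<le> C * dt ^ (k + 1)"
    by auto
  obtain Ct where Ct: "\<And>tn dt. \<bar>tn\<bar> \<le> T \<Longrightarrow> 0 < dt \<Longrightarrow> dt \<le> 1 \<Longrightarrow>
      norm (substep_defect k p B P y tn dt m) \<le> Ct * dt ^ (k + 1)"
    using substep_defect_bound[OF deriv p1 mp, of T k P] by blast
  define A where "A = (\<Sum>l<k. \<bar>ab_alpha k l\<bar>) * onorm ((*v) (B ** P))"
  have A0: "A \<ge> 0" unfolding A_def by (simp add: norm_matrix_vector_le sum_nonneg)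
  define C' where "C' = C + \<bar>Ct\<bar> + A * C"
  have "norm (stage_err k p B P y tn dt j) \<le> C' * dt ^ (k + 1)"
    if tn: "\<bar>tn\<bar> \<le> T" and dt0: "0 < dt" and dt1: "dt \<le> 1" and j: "j \<le> Suc m" for tn dt j
  proof -
    have "C * dt ^ (k + 1) \<le> C' * dt ^ (k + 1)"
      using C0 A0 dt0 by (intro mult_right_mono) (auto simp: C'_def)
    moreover have "norm (stage_err k p B P y tn dt (Suc m))
        \<le> C * dt ^ (k + 1) + norm (substep_defect k p B P y tn dt m) + A * (C * dt ^ (k + 1))"
      unfolding A_def by (rule stage_err_propagation[OF proj mp dt0 dt1 C[OF tn dt0 dt1]])
    moreover have "Ct * dt ^ (k + 1) \<le> \<bar>Ct\<bar> * dt ^ (k + 1)" using dt0 by (intro mult_right_mono) auto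
    ultimately show ?thesis
      using j C[OF tn dt0 dt1, of j] Ct[OF tn dt0 dt1] unfolding C'_def le_Suc_eq
      by (auto simp: algebra_simps)
  qed
  then show ?case using C0 A0 by (intro exI[of _ C']) (auto simp: C'_def)
qed


section \<open>Consistency of the LTS-ABk(p) step\<close>

theorem mainTheorem2:
  fixes k p :: nat and B P :: "real^'n^'n" and y :: "real \<Rightarrow> real^'n"
  assumes "k \<ge> 1" and "p \<ge> 1"
    and "\<forall>i j. i \<noteq> j \<longrightarrow> P $ i $ j = 0"
    and "\<forall>i. P $ i $ i = 0 \<or> P $ i $ i = 1"
    and "\<forall>t. (y has_vector_derivative (B *v y t)) (at t)"
  shows "\<forall>T. \<exists>C \<delta>. \<delta> > 0 \<and>
           (\<forall>tn dt. \<bar>tn\<bar> \<le> T \<longrightarrow> 0 < dt \<longrightarrow> dt < \<delta> \<longrightarrow>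
              norm (lts_step k p B P dt (\<lambda>l. y (tn - real l * dt))
                      (\<lambda>j. P *v y (tn - real j * dt / real p))
                    - y (tn + dt)) \<le> C * dt ^ (k + 1))"
proof
  fix T :: real
  have proj: "P ** P = P" using projection_idempotent assms(3,4) .
  obtain C where C: "\<And>tn dt. \<bar>tn\<bar> \<le> T \<Longrightarrow> 0 < dt \<Longrightarrow> dt \<le> 1 \<Longrightarrow>
      norm (stage_err k p B P y tn dt p) \<le> C * dt ^ (k + 1)"
    using stage_err_bound[OF assms(5,2) proj order_refl, of T] by blast
  text \<open>The last stage is the result of the step, at time t_n + p (dt / p) = t_n + dt.\<close>
  have "stage_err k p B P y tn dt p
      = lts_step k p B P dt (\<lambda>l. y (tn - real l * dt)) (\<lambda>j. P *v y (tn - real j * dt / real p)) - y (tn + dt)"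
    for tn dt using assms(2) by (simp add: stage_err_def stage_def lts_step_def)
  then show "\<exists>C \<delta>. \<delta> > 0 \<and> (\<forall>tn dt. \<bar>tn\<bar> \<le> T \<longrightarrow> 0 < dt \<longrightarrow> dt < \<delta> \<longrightarrow>
      norm (lts_step k p B P dt (\<lambda>l. y (tn - real l * dt)) (\<lambda>j. P *v y (tn - real j * dt / real p))
            - y (tn + dt)) \<le> C * dt ^ (k + 1))"
    using C by (intro exI[of _ C] exI[of _ 1]) auto
qed

end
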